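(* Let $c$ be a constant with $0<c<\frac12$. There exists a real constant $\delta=\delta(c)>0$ such that for every $n\in\mathbb{N}$ and every integer $k$ with $cn<k<(1-c)n$, $$\max\{\beta_{[\pm1]}(n,k),\beta_{[\pm1]}(n,k-1),\beta_{[\pm1]}(n,k-2),\beta_{[\pm1]}(n,k-3)\}\ge \delta n.$$
   Context: For a positive integer $n$, $[n]=\{1,\dots,n\}$ and $\binom{[n]}{k}$ is the family of all $k$-element subsets of $[n]$. For a set $D$ of integers and families $\mathcal{F},\mathcal{F}'$ of subsets of $[n]$, $\mathcal{F}'$ is called $D$-secting for $\mathcal{F}$ if for every $A\in\mathcal{F}$ there exists $A'\in\mathcal{F}'$ with $|A\cap A'|-|A\cap([n]\setminus A')|\in D$. $\beta_D(\mathcal{F})$ is the minimum cardinality of a $D$-secting family for $\mathcal{F}$; $\beta_{[\pm 1]}$ denotes $\beta_D$ with $D=\{-1,0,1\}$. $\beta_{[\pm1]}(n,k)$ is the maximum of $\beta_{[\pm1]}(\mathcal{F})$ over all families $\mathcal{F}\subseteq\binom{[n]}{k}$. *)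

theory Defs
  imports Complex_Main
begin

definition D_secting :: "nat \<Rightarrow> int set \<Rightarrow> nat set set \<Rightarrow> nat set set \<Rightarrow> bool" where
  "D_secting n D F F' \<longleftrightarrow>
     (\<forall>A\<in>F. \<exists>A'\<in>F'. int (card (A \<inter> A')) - int (card (A \<inter> ({1..n} - A'))) \<in> D)"

definition beta :: "nat \<Rightarrow> int set \<Rightarrow> nat set set \<Rightarrow> nat" where
  "beta n D F = Min {card F' | F'. F' \<subseteq> Pow {1..n} \<and> D_secting n D F F'}"

text \<open>The size \<open>k\<close> is an integer so that \<open>k - 1\<close>, \<open>k - 2\<close>, \<open>k - 3\<close> are not truncated
  at zero; for negative \<open>k\<close> there are no \<open>k\<close>-element subsets.\<close>

definition k_subsets :: "nat \<Rightarrow> int \<Rightarrow> nat set set" where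
  "k_subsets n k = {A. A \<subseteq> {1..n} \<and> int (card A) = k}"

definition beta_pm1 :: "nat \<Rightarrow> int \<Rightarrow> nat" where
  "beta_pm1 n k = Max {beta n {-1, 0, 1} F | F. F \<subseteq> k_subsets n k}"

text \<open>The sets under \<^const>\<open>Min\<close> and \<^const>\<open>Max\<close> are finite and, for \<open>D = {-1, 0, 1}\<close>, nonempty,
  so the minimum and the maximum are attained.\<close>

lemma finite_beta_set: "finite {card F' | F'. F' \<subseteq> Pow {1..n} \<and> D_secting n D F F'}"
proof -
  have "{card F' | F'. F' \<subseteq> Pow {1..n} \<and> D_secting n D F F'} \<subseteq> card ` Pow (Pow {1..n})"
    by auto
  then show ?thesis
    by (rule finite_subset) simp
qed

lemma D_secting_Pow:
  assumes "F \<subseteq> Pow {1..n}"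
  shows "D_secting n {-1, 0, 1} F (Pow {1..n})"
  unfolding D_secting_def
proof
  fix A assume "A \<in> F"
  with assms have A: "A \<subseteq> {1..n}" by auto
  then have fin: "finite A" by (rule finite_subset) simp
  obtain B where B: "B \<subseteq> A" "card B = card A div 2"
    by (meson obtain_subset_with_card_n div_le_dividend)
  have "A \<inter> B = B" "A \<inter> ({1..n} - B) = A - B" using A B by auto
  moreover have "card (A - B) = card A - card A div 2"
    using B fin by (simp add: card_Diff_subset finite_subset)
  ultimately have "int (card (A \<inter> B)) - int (card (A \<inter> ({1..n} - B))) \<in> {-1, 0, 1}"
    using B(2) by simp presburger
  then show "\<exists>A'\<in>Pow {1..n}. int (card (A \<inter> A')) - int (card (A \<inter> ({1..n} - A'))) \<in> {-1, 0, 1}"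
    using A B by blast
qed

lemma beta_attained:
  assumes "F \<subseteq> Pow {1..n}"
  shows "\<exists>F'. F' \<subseteq> Pow {1..n} \<and> D_secting n {-1, 0, 1} F F' \<and> card F' = beta n {-1, 0, 1} F"
proof -
  have "{card F' | F'. F' \<subseteq> Pow {1..n} \<and> D_secting n {-1, 0, 1} F F'} \<noteq> {}"
    using D_secting_Pow[OF assms] by blast
  from Min_in[OF finite_beta_set this]
  have "beta n {-1, 0, 1} F \<in> {card F' | F'. F' \<subseteq> Pow {1..n} \<and> D_secting n {-1, 0, 1} F F'}"
    unfolding beta_def .
  then show ?thesis
    unfolding mem_Collect_eq by metis
qed

lemma beta_pm1_attained:
  "\<exists>F. F \<subseteq> k_subsets n k \<and> beta n {-1, 0, 1} F = beta_pm1 n k"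
proof -
  let ?S = "{beta n {-1, 0, 1} F | F. F \<subseteq> k_subsets n k}"
  have "?S = beta n {-1, 0, 1} ` Pow (k_subsets n k)" by auto
  moreover have "finite (k_subsets n k)"
    by (rule finite_subset[of _ "Pow {1..n}"]) (auto simp: k_subsets_def)
  ultimately have "finite ?S" by simp
  moreover have "?S \<noteq> {}" by auto
  ultimately have "beta_pm1 n k \<in> ?S"
    unfolding beta_pm1_def by (rule Max_in)
  then show ?thesis
    unfolding mem_Collect_eq by metis
qed

end

theory Submission imports Defs "HOL-Library.FuncSet"
begin

text \<open>One of the four sizes is some \<open>K\<close> with \<open>K mod 4 = 2\<close>. A set that splits a \<open>K\<close>-set \<open>A\<close> with discrepancy
  at most 1 meets \<open>A\<close> in \<open>K / 2\<close> points, an odd number. Given \<open>m\<close> sets that split all \<open>K\<close>-sets, classify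
  the \<open>h\<close>-subsets of a \<open>2h\<close>-set by the parities of their intersections with these \<open>m\<close> sets. If \<open>x\<close> and \<open>y\<close>
  lie in the same class, their symmetric difference meets each of the \<open>m\<close> sets evenly, so it does not have
  \<open>K\<close> elements, that is, the intersection of \<open>x\<close> and \<open>y\<close> does not have \<open>l = h - K / 2\<close> elements. The
  largest of the \<open>2^m\<close> classes would, for small \<open>m\<close>, contradict the theorem of Frankl and Roedl that
  families with a forbidden cross intersection size are exponentially small.

  That theorem is proved here for \<open>l \<le> N / 4\<close> by a density increment. Split \<open>F\<close> and \<open>G\<close> at a point into
  the parts \<open>F0\<close>, \<open>G0\<close> avoiding it and the links \<open>F1\<close>, \<open>G1\<close>, and let \<open>F\<close>, \<open>G\<close> avoid intersection sizes in
  \<open>[a, b]\<close>. Then \<open>F0 \<union> F1\<close>, \<open>G0\<close> still avoid \<open>[a, b]\<close>, while \<open>F1\<close>, \<open>G1\<close> avoid \<open>[a - 1, b - 1]\<close>, and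
  \<open>F0 \<inter> F1\<close>, \<open>G1\<close> avoid the longer interval \<open>[a - 1, b]\<close>. If neither of the first two pairs (nor their
  mirror images) is noticeably denser, the third pair is hardly sparser. The interval therefore grows
  until it contains every possible intersection size.\<close>

section \<open>Exponential estimates and the potential\<close>

lemma exp_le_quadratic:
  fixes x :: real
  assumes "\<bar>x\<bar> \<le> 1"
  shows "exp x \<le> 1 + x + x\<^sup>2"
proof (cases "0 \<le> x")
  case True
  then show ?thesis using exp_bound[of x] assms by simp
next
  case False
  \<comment> \<open>For negative \<open>x\<close>, it suffices that this Taylor lower bound for
    \<open>exp (-x)\<close>, times \<open>1 + x + x^2\<close>, is at least 1.\<close>
  have "1 - x + x^2/2 \<le> exp (-x)"
    using exp_lower_Taylor_quadratic[of "-x"] False by simp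
  moreover have "(1 - x + x^2/2) * (1 + x + x^2) = 1 + x^2/2 + (x^4 - x^3)/2"
    by (simp add: field_simps power2_eq_square power3_eq_cube power4_eq_xxxx)
  moreover have "x^3 \<le> 0" using False by (simp add: power_le_zero_eq)
  moreover have "0 \<le> x^4" by simp
  ultimately have "1 \<le> (1 - x + x^2/2) * (1 + x + x^2)"
    using zero_le_power2[of x] by argo
  also have "\<dots> \<le> exp (-x) * (1 + x + x^2)"
  proof (rule mult_right_mono)
    have "0 \<le> x^2" by simp
    then show "0 \<le> 1 + x + x^2" using assms by linarith
  qed fact
  finally have "1 \<le> exp (-x) * (1 + x + x^2)" .
  then show ?thesis by (simp add: exp_minus field_simps)
qed

text \<open>With \<open>d = 4 * e / s\<close>, the bound on \<open>(2 - Q) * (2 - Q')\<close> forces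
  \<open>1 - Q\<close> and then \<open>P - 1\<close> to be of order \<open>d\<close>. The choice of
  \<open>e\<close> gives \<open>d^2 = e / 125\<close>, so \<open>(P - 1) * (1 - Q)\<close> stays
  below the \<open>e / 10\<close> demanded by the other bounds.\<close>

lemma density_step_contradiction:
  fixes P P' Q Q' e s :: real
  assumes s: "0 < s" "s \<le> 1/4" and e: "e = s\<^sup>2 / 2000"
    and P: "1 \<le> P" "1 \<le> P'"
    and PQ: "P * Q < exp e" "P' * Q' < exp e"
    and QQ: "(2 - Q) * (2 - Q') < exp (4 * e / s)"
    and shrink: "(2 - P) * (2 - Q) < exp (- (3/2 * e))" "(2 - P') * (2 - Q') < exp (- (3/2 * e))"
  shows False
proof -
  define d where "d = 4 * e / s"
  have d: "d = s / 500" using s by (simp add: d_def e power2_eq_square)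
  have dd: "d^2 = e / 125" by (simp add: d e power2_eq_square)
  have e_pos: "0 < e" using s by (simp add: e)
  have d_bounds: "0 < d" "d \<le> 1/2000" using s by (simp_all add: d)
  have "d * d \<le> d * (1/2000)" using d_bounds by (intro mult_left_mono) auto
  then have "e \<le> d / 16" using dd by (simp add: power2_eq_square)
  then have e_small: "e \<le> d / 16" "e \<le> 1/1000" using d_bounds by auto
  have "e * e \<le> e * (1/1000)" using e_small e_pos by (intro mult_left_mono) auto
  then have ee: "e^2 \<le> e / 1000" by (simp add: power2_eq_square)
  have exp_e: "exp e \<le> 1 + e + e / 1000"
    using exp_le_quadratic[of e] e_pos e_small ee by simp
  have exp_d: "exp d \<le> 1 + d + d / 10"
    using exp_le_quadratic[of d] d_bounds dd e_small by simp
  have exp_m: "exp (- (3/2 * e)) \<le> 1 - 3/2 * e + e / 100"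
    using exp_le_quadratic[of "- (3/2 * e)"] e_pos e_small ee by (simp add: power_mult_distrib power_divide)
  \<comment> \<open>The two products add up to \<open>2 - 2 (P - 1) (1 - Q)\<close>, so only this second-order term can make both small.\<close>
  have gap: "(P - 1) * (1 - Q) > e / 10"
    if "P * Q < exp e" "(2 - P) * (2 - Q) < exp (- (3/2 * e))" for P Q
  proof -
    have "(2 - P) * (2 - Q) + P * Q = 2 - 2 * ((P - 1) * (1 - Q))"
      by (simp add: algebra_simps)
    with that exp_e exp_m e_pos show ?thesis by linarith
  qed
  have gaps: "(P - 1) * (1 - Q) > e / 10" "(P' - 1) * (1 - Q') > e / 10"
    using gap PQ shrink by auto
  then have "0 < (P - 1) * (1 - Q)" "0 < (P' - 1) * (1 - Q')" using e_pos by linarith+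
  then have "Q < 1" "Q' < 1"
    using P by (auto simp: zero_less_mult_iff)
  \<comment> \<open>\<open>Q' < 1\<close>, obtained from the mirror-image pair, lets the factor
    \<open>2 - Q'\<close> be dropped.\<close>
  then have "2 - Q \<le> (2 - Q) * (2 - Q')" by simp
  then have Q_close: "1 - Q < 11/10 * d" using QQ exp_d unfolding d_def[symmetric] by linarith
  then have "Q > 99/100" using d_bounds by linarith
  then have "(P - 1) * (99/100) \<le> (P - 1) * Q" using P by (intro mult_left_mono) auto
  also have "\<dots> = P * Q - Q" by (simp add: algebra_simps)
  also have "\<dots> < 3/2 * d" using PQ(1) exp_e Q_close e_small(1) d_bounds(1) by argo
  finally have "P - 1 \<le> 2 * d" using d_bounds(1) by argo
  then have "(P - 1) * (1 - Q) \<le> (2 * d) * (11/10 * d)"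
    using P Q_close \<open>Q < 1\<close> d_bounds by (intro mult_mono) auto
  also have "\<dots> = 22/10 * d^2" by (simp add: power2_eq_square)
  finally show False using gaps(1) dd e_pos by simp
qed

text \<open>The potential is the negative logarithm of the density bound that an induction deleting the
  points of the ground set one at a time can maintain for families avoiding intersection sizes in
  \<open>[a, b]\<close>. A deletion either keeps \<open>[a, b]\<close> and gains a factor \<open>exp e\<close> in density, or moves it down
  by one and gains \<open>exp (4 * e / s)\<close>, or enlarges it to \<open>[a - 1, b]\<close> and loses at most
  \<open>exp (3/2 * e)\<close>; these three rates determine the coefficients of \<open>n\<close>, \<open>a\<close> and \<open>b\<close>. The constant
  term makes the potential nonpositive where the induction stops, at \<open>n = 0\<close>, unless \<open>[a, b]\<close>
  contains \<open>0\<close>, and then one of the two families is empty.\<close>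

definition potential :: "real \<Rightarrow> real \<Rightarrow> nat \<Rightarrow> nat \<Rightarrow> int \<Rightarrow> int \<Rightarrow> real" where
  "potential e s l n a b =
     (4 * e / s + 3/2 * e) * b + e * n - 5/2 * e * a - (4 * e / s + 5/2 * e) * l"

lemma potential_step:
  "potential e s l (Suc n) a b = potential e s l n a b + e"
  "potential e s l (Suc n) a b = potential e s l n (a - 1) (b - 1) + 4 * e / s"
  "potential e s l (Suc n) a b = potential e s l n (a - 1) b - 3/2 * e"
  by (simp_all add: potential_def algebra_simps diff_divide_distrib add_divide_distrib)

section \<open>Cross-avoiding families and the density increment\<close>

definition cross_avoiding :: "'a set set \<Rightarrow> 'a set set \<Rightarrow> int \<Rightarrow> int \<Rightarrow> bool" where
  "cross_avoiding F G a b \<longleftrightarrow> (\<forall>x\<in>F. \<forall>y\<in>G. int (card (x \<inter> y)) \<notin> {a..b})"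

lemma cross_avoiding_sym: "cross_avoiding F G a b \<longleftrightarrow> cross_avoiding G F a b"
  unfolding cross_avoiding_def by (metis Int_commute)

text \<open>Here \<open>f0\<close>, \<open>f1\<close> are the sizes of the two parts of a family of
  size \<open>f\<close>, and \<open>u\<close>, \<open>i\<close> those of their union and
  intersection; \<open>g0\<close>, \<open>g1\<close>, \<open>u'\<close>, \<open>i'\<close> belong to
  the other family. If \<open>f * g > 4 * X\<close>, division by \<open>f / 2\<close> and
  \<open>g / 2\<close> yields the excluded configuration of densities.\<close>

lemma density_increment:
  fixes u i f f0 f1 u' i' g g0 g1 X e s :: real
  assumes s: "0 < s" "s \<le> 1/4" and e: "e = s\<^sup>2 / 2000"
    and f: "u + i = f" "f0 + f1 = f" "i \<le> u" "0 \<le> i"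
    and g: "u' + i' = g" "g0 + g1 = g" "i' \<le> u'" "0 \<le> i'"
    and X: "0 \<le> X"
    and keep: "u * g0 \<le> X * exp e" "u' * f0 \<le> X * exp e"
    and shift: "f1 * g1 \<le> X * exp (4 * e / s)"
    and grow: "i * g1 \<le> X * exp (- (3/2 * e))" "i' * f1 \<le> X * exp (- (3/2 * e))"
  shows "f * g \<le> 4 * X"
proof (rule ccontr)
  assume less: "\<not> f * g \<le> 4 * X"
  have "0 \<le> f" "0 \<le> g" using f g by auto
  moreover have "f \<noteq> 0" "g \<noteq> 0" using less X by auto
  ultimately have pos: "0 < f" "0 < g" by auto
  have normalise: "(2 * p / f) * (2 * q / g) < c"
    if "p * q \<le> X * c" "0 < c" for p q c
  proof -
    have "4 * (p * q) \<le> (4 * X) * c" using that by simp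
    also have "\<dots> < (f * g) * c" using less that by (intro mult_strict_right_mono) auto
    finally show ?thesis using pos by (simp add: field_simps)
  qed
  have compl: "2 - 2 * u / f = 2 * i / f" "2 - 2 * g0 / g = 2 * g1 / g"
    "2 - 2 * u' / g = 2 * i' / g" "2 - 2 * f0 / f = 2 * f1 / f"
    using pos f g by (auto simp: field_simps)
  show False
  proof (rule density_step_contradiction[OF s e, of "2 * u / f" "2 * u' / g" "2 * g0 / g" "2 * f0 / f"])
    show "1 \<le> 2 * u / f" "1 \<le> 2 * u' / g"
      using pos f g by (auto simp: field_simps)
    show "2 * u / f * (2 * g0 / g) < exp e" using normalise[OF keep(1)] by simp
    show "2 * u' / g * (2 * f0 / f) < exp e"
      using normalise[of f0 u'] keep(2) by (simp add: mult.commute)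
    show "(2 - 2 * g0 / g) * (2 - 2 * f0 / f) < exp (4 * e / s)"
      unfolding compl using normalise[OF shift] by (simp add: mult.commute)
    show "(2 - 2 * u / f) * (2 - 2 * g0 / g) < exp (- (3/2 * e))"
      unfolding compl using normalise[OF grow(1)] by simp
    show "(2 - 2 * u' / g) * (2 - 2 * f0 / f) < exp (- (3/2 * e))"
      unfolding compl using normalise[of f1 i'] grow(2) by (simp add: mult.commute)
  qed
qed

lemma card_split_point:
  assumes "finite S" "p \<notin> S" "F \<subseteq> Pow (insert p S)"
  shows "card {x \<in> Pow S. x \<in> F} + card {x \<in> Pow S. insert p x \<in> F} = card F"
proof -
  have fin: "finite F" using assms finite_subset by blast
  have "F = {x \<in> Pow S. x \<in> F} \<union> insert p ` {x \<in> Pow S. insert p x \<in> F}"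
  proof (intro equalityI subsetI)
    fix x assume x: "x \<in> F"
    show "x \<in> {x \<in> Pow S. x \<in> F} \<union> insert p ` {x \<in> Pow S. insert p x \<in> F}"
    proof (cases "p \<in> x")
      case True
      then have "x = insert p (x - {p})" "x - {p} \<in> Pow S" using x assms by auto
      then show ?thesis using x by (metis (mono_tags, lifting) UnI2 image_eqI mem_Collect_eq)
    next
      case False
      then show ?thesis using x assms by auto
    qed
  qed auto
  moreover have "card ({x \<in> Pow S. x \<in> F} \<union> insert p ` {x \<in> Pow S. insert p x \<in> F})
      = card {x \<in> Pow S. x \<in> F} + card (insert p ` {x \<in> Pow S. insert p x \<in> F})"
    using assms by (intro card_Un_disjoint) auto
  moreover have "card (insert p ` {x \<in> Pow S. insert p x \<in> F}) = card {x \<in> Pow S. insert p x \<in> F}"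
  proof (intro card_image inj_onI)
    fix x y assume "x \<in> {x \<in> Pow S. insert p x \<in> F}" "y \<in> {x \<in> Pow S. insert p x \<in> F}"
      and eq: "insert p x = insert p y"
    then have "p \<notin> x" "p \<notin> y" using assms by auto
    then show "x = y" using eq by (metis insert_ident)
  qed
  ultimately show ?thesis by simp
qed

text \<open>Intersections grow by one only when \<open>p\<close> is added to both sets. A set in
  \<open>F0 \<inter> F1\<close> inherits both restrictions against \<open>G1\<close>, and
  \<open>a \<le> b\<close> makes the two intervals cover \<open>[a - 1, b]\<close>.\<close>

lemma cross_avoiding_delete_point:
  assumes "finite S" "p \<notin> S" and ab: "a \<le> b" and av: "cross_avoiding F G a b"
  defines "F0 \<equiv> {x \<in> Pow S. x \<in> F}" and "F1 \<equiv> {x \<in> Pow S. insert p x \<in> F}"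
    and "G0 \<equiv> {x \<in> Pow S. x \<in> G}" and "G1 \<equiv> {x \<in> Pow S. insert p x \<in> G}"
  shows "cross_avoiding (F0 \<union> F1) G0 a b"
    and "cross_avoiding F1 G1 (a - 1) (b - 1)"
    and "cross_avoiding (F0 \<inter> F1) G1 (a - 1) b"
proof -
  have av': "int (card (x \<inter> y)) \<notin> {a..b}" if "x \<in> F" "y \<in> G" for x y
    using av that by (auto simp: cross_avoiding_def)
  have add: "card (insert p x \<inter> insert p y) = Suc (card (x \<inter> y))" if "x \<subseteq> S" "y \<subseteq> S" for x y
  proof -
    have "insert p x \<inter> insert p y = insert p (x \<inter> y)" by auto
    moreover have "finite (x \<inter> y)" "p \<notin> x \<inter> y" using that assms(1,2) by (auto intro: finite_subset)
    ultimately show ?thesis by simp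
  qed
  have one: "insert p x \<inter> y = x \<inter> y" "x \<inter> insert p y = x \<inter> y" if "x \<subseteq> S" "y \<subseteq> S" for x y
    using that assms(2) by auto
  show "cross_avoiding (F0 \<union> F1) G0 a b"
    unfolding cross_avoiding_def F0_def F1_def G0_def using av' one by fastforce
  show shift: "cross_avoiding F1 G1 (a - 1) (b - 1)"
    unfolding cross_avoiding_def
  proof (intro ballI)
    fix x y assume "x \<in> F1" "y \<in> G1"
    then show "int (card (x \<inter> y)) \<notin> {a - 1..b - 1}"
      using av'[of "insert p x" "insert p y"] add[of x y] by (auto simp: F1_def G1_def)
  qed
  show "cross_avoiding (F0 \<inter> F1) G1 (a - 1) b"
    unfolding cross_avoiding_def
  proof (intro ballI)
    fix x y assume xy: "x \<in> F0 \<inter> F1" "y \<in> G1"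
    have "int (card (x \<inter> y)) \<notin> {a..b}"
      using av'[of x "insert p y"] one(2)[of x y] xy by (auto simp: F0_def G1_def)
    moreover have "int (card (x \<inter> y)) \<notin> {a - 1..b - 1}"
      using shift xy by (auto simp: cross_avoiding_def)
    ultimately show "int (card (x \<inter> y)) \<notin> {a - 1..b}" using ab by auto
  qed
qed

lemma cross_avoiding_terminal_bound:
  fixes e s :: real and l N :: nat
  assumes s: "0 < s" and e: "0 < e" and l: "s * N \<le> l"
    and FG: "F \<subseteq> {{}}" "G \<subseteq> {{}}" and av: "cross_avoiding F G a b"
    and b: "b \<le> int l" and a: "- int N \<le> a"
  shows "real (card F) * real (card G) \<le> exp (- potential e s l 0 a b)"
proof -
  define r where "r = 4 * e / s"
  have r: "0 < r" "r * s = 4 * e" using s e by (simp_all add: r_def)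
  have pot: "potential e s l 0 a b = r * (b - l) + e * (3/2 * b - 5/2 * a - 5/2 * l)"
    unfolding potential_def r_def[symmetric] by (simp add: algebra_simps)
  have nonpos: ?thesis if "potential e s l 0 a b \<le> 0"
  proof -
    have "card H \<le> 1" if "H \<subseteq> {{}}" for H :: "'a set set"
      using card_mono[OF _ that] by simp
    then have "real (card F) * real (card G) \<le> 1 * 1"
      using FG by (intro mult_mono) (auto simp: le_Suc_eq)
    also have "\<dots> \<le> exp (- potential e s l 0 a b)" using that by simp
    finally show ?thesis .
  qed
  consider "b < 0" | "a \<le> 0" "0 \<le> b" | "1 \<le> a" "0 \<le> b" by linarith
  then show ?thesis
  proof cases
    case 1
    \<comment> \<open>As \<open>a\<close> may be as low as \<open>- N\<close>, the term
      \<open>- r * l \<le> - 4 * e * N\<close> has to outweigh \<open>- 5/2 * e * a\<close>.\<close>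
    have "r * (s * N) \<le> r * l" using l r by (intro mult_left_mono) auto
    moreover have "r * (s * N) = e * (4 * N)" using r(2) by (simp flip: mult.assoc)
    moreover have "r * b \<le> 0" using 1 r by (simp add: mult_nonneg_nonpos)
    moreover have "e * (3/2 * b - 5/2 * a - 5/2 * l) \<le> e * (4 * N)"
    proof (rule mult_left_mono)
      have "real_of_int b \<le> 0" "- real N \<le> a" using 1 a by linarith+
      then show "3/2 * b - 5/2 * a - 5/2 * l \<le> real (4 * N)" by simp
    qed (use e in simp)
    ultimately have "potential e s l 0 a b \<le> 0"
      unfolding pot by (simp add: right_diff_distrib)
    then show ?thesis by (rule nonpos)
  next
    case 2
    have "F = {} \<or> G = {}"
      using av 2 FG by (auto simp: cross_avoiding_def subset_singleton_iff)
    then show ?thesis by auto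
  next
    case 3
    have "r * (b - l) \<le> 0" using b r by (simp add: mult_nonneg_nonpos)
    moreover have "3/2 * b - 5/2 * a - 5/2 * l \<le> 0"
    proof -
      have "1 \<le> real_of_int a" "real_of_int b \<le> l" using 3 b by linarith+
      then show ?thesis by simp
    qed
    then have "e * (3/2 * b - 5/2 * a - 5/2 * l) \<le> 0"
      using e by (simp add: mult_nonneg_nonpos)
    ultimately have "potential e s l 0 a b \<le> 0" unfolding pot by linarith
    then show ?thesis by (rule nonpos)
  qed
qed

text \<open>A deletion lowers \<open>a\<close> by at most one and never raises \<open>b\<close>, so
  the bounds on \<open>a\<close> and \<open>b\<close> survive the induction. The endpoints are
  integers because the interval may move below zero.\<close>

lemma cross_avoiding_potential_bound:
  fixes e s :: real and l N :: nat
  assumes s: "0 < s" "s \<le> 1/4" and e: "e = s\<^sup>2 / 2000" and l: "s * N \<le> l"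
    and "finite S" "card S \<le> N" "F \<subseteq> Pow S" "G \<subseteq> Pow S"
    and "cross_avoiding F G a b" "a \<le> b" "b \<le> int l" "int (card S) - int N \<le> a"
  shows "real (card F) * real (card G) \<le> 4 ^ card S * exp (- potential e s l (card S) a b)"
  using assms(5-)
proof (induction S arbitrary: F G a b rule: finite_induct)
  case (empty F G a b)
  have "0 < e" using s by (simp add: e)
  from cross_avoiding_terminal_bound[OF s(1) this l] show ?case using empty by simp
next
  case (insert p S F G a b)
  let ?F0 = "{x \<in> Pow S. x \<in> F}" and ?F1 = "{x \<in> Pow S. insert p x \<in> F}"
  let ?G0 = "{x \<in> Pow S. x \<in> G}" and ?G1 = "{x \<in> Pow S. insert p x \<in> G}"
  have card_ins: "card (insert p S) = Suc (card S)" using insert by simp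
  have fins: "finite ?F0" "finite ?F1" "finite ?G0" "finite ?G1" using insert(1) by auto
  \<comment> \<open>A quarter of the target bound; changes of potential then appear as factors
    \<open>exp t\<close>.\<close>
  define X where "X = 4 ^ card S * exp (- potential e s l (Suc (card S)) a b)"
  have IH: "real (card A) * real (card B) \<le> X * exp t"
    if "cross_avoiding A B a' b'" "A \<subseteq> Pow S" "B \<subseteq> Pow S" "a' \<le> b'" "b' \<le> b" "a - 1 \<le> a'"
      and "potential e s l (Suc (card S)) a b = potential e s l (card S) a' b' + t" for A B a' b' t
  proof -
    have "real (card A) * real (card B) \<le> 4 ^ card S * exp (- potential e s l (card S) a' b')"
      using that insert.prems card_ins by (intro insert.IH) auto
    also have "\<dots> = X * exp t" using that by (simp add: X_def flip: exp_add)
    finally show ?thesis .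
  qed
  note del = cross_avoiding_delete_point[OF insert(1,2) insert.prems(5,4)]
  note del' = cross_avoiding_delete_point[OF insert(1,2) insert.prems(5) insert.prems(4)[THEN cross_avoiding_sym[THEN iffD1]]]
  have "real (card F) * real (card G) \<le> 4 * X"
  proof (rule density_increment[OF s e])
    show "real (card (?F0 \<union> ?F1)) + real (card (?F0 \<inter> ?F1)) = card F"
      using card_Un_Int[OF fins(1,2)] card_split_point[OF insert(1,2) insert.prems(2)] by simp
    show "real (card (?G0 \<union> ?G1)) + real (card (?G0 \<inter> ?G1)) = card G"
      using card_Un_Int[OF fins(3,4)] card_split_point[OF insert(1,2) insert.prems(3)] by simp
    show "real (card ?F0) + real (card ?F1) = card F"
      using card_split_point[OF insert(1,2) insert.prems(2)] by simp
    show "real (card ?G0) + real (card ?G1) = card G"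
      using card_split_point[OF insert(1,2) insert.prems(3)] by simp
    show "real (card (?F0 \<inter> ?F1)) \<le> real (card (?F0 \<union> ?F1))"
      using fins by (intro of_nat_mono card_mono) auto
    show "real (card (?G0 \<inter> ?G1)) \<le> real (card (?G0 \<union> ?G1))"
      using fins by (intro of_nat_mono card_mono) auto
    show "real (card (?F0 \<union> ?F1)) * real (card ?G0) \<le> X * exp e"
      by (rule IH[OF del(1)]) (use insert.prems(5) in \<open>auto simp: potential_step(1)\<close>)
    show "real (card (?G0 \<union> ?G1)) * real (card ?F0) \<le> X * exp e"
      by (rule IH[OF del'(1)]) (use insert.prems(5) in \<open>auto simp: potential_step(1)\<close>)
    show "real (card ?F1) * real (card ?G1) \<le> X * exp (4 * e / s)"
      by (rule IH[OF del(2)]) (use insert.prems(5) in \<open>auto simp: potential_step(2)\<close>)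
    show "real (card (?F0 \<inter> ?F1)) * real (card ?G1) \<le> X * exp (- (3/2 * e))"
      by (rule IH[OF del(3)]) (use insert.prems(5) in \<open>auto simp: potential_step(3)\<close>)
    show "real (card (?G0 \<inter> ?G1)) * real (card ?F1) \<le> X * exp (- (3/2 * e))"
      by (rule IH[OF del'(3)]) (use insert.prems(5) in \<open>auto simp: potential_step(3)\<close>)
  qed (auto simp: X_def)
  then show ?case by (simp add: card_ins X_def)
qed

text \<open>The one-point interval \<open>[l, l]\<close> has potential
  \<open>e * (N - 7/2 * l)\<close>, at least \<open>e * N / 8\<close> since
  \<open>4 * l \<le> N\<close>; hence \<open>16000 = 8 * 2000\<close>.\<close>

lemma forbidden_cross_intersection:
  fixes s :: real and l N :: nat
  assumes s: "0 < s" "s \<le> 1/4" and l: "s * N \<le> l" "4 * l \<le> N"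
    and S: "finite S" "card S = N" and FG: "F \<subseteq> Pow S" "G \<subseteq> Pow S"
    and av: "\<And>x y. x \<in> F \<Longrightarrow> y \<in> G \<Longrightarrow> card (x \<inter> y) \<noteq> l"
  shows "real (card F) * real (card G) \<le> 4 ^ N * exp (- (s\<^sup>2 / 16000 * N))"
proof -
  define e where "e = s\<^sup>2 / 2000"
  have "cross_avoiding F G (int l) (int l)"
    using av by (auto simp: cross_avoiding_def)
  then have "real (card F) * real (card G) \<le> 4 ^ card S * exp (- potential e s l (card S) (int l) (int l))"
    by (intro cross_avoiding_potential_bound[OF s e_def l(1)]) (use S FG in auto)
  also have "\<dots> \<le> 4 ^ N * exp (- (s\<^sup>2 / 16000 * N))"
  proof -
    have "potential e s l N (int l) (int l) = e * (N - 7/2 * l)"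
      by (simp add: potential_def algebra_simps)
    moreover have "e * (N / 8) \<le> e * (N - 7/2 * l)"
      using l(2) by (intro mult_left_mono) (auto simp: e_def)
    moreover have "e * (N / 8) = s\<^sup>2 / 16000 * N" by (simp add: e_def)
    ultimately have "s\<^sup>2 / 16000 * N \<le> potential e s l N (int l) (int l)" by linarith
    then show ?thesis using S by simp
  qed
  finally show ?thesis .
qed

section \<open>From secting families to forbidden intersections\<close>

lemma card_sym_diff:
  assumes "finite x" "finite y"
  shows "card (sym_diff x y) + 2 * card (x \<inter> y) = card x + card y"
proof -
  have "card (sym_diff x y) = card (x - y) + card (y - x)"
    using assms by (intro card_Un_disjoint) auto
  moreover have "card (x - y) + card (x \<inter> y) = card x" "card (y - x) + card (x \<inter> y) = card y"
    using assms card_Int_Diff[of x y] card_Int_Diff[of y x] by (simp_all add: Int_commute)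
  ultimately show ?thesis by simp
qed

lemma secting_family_lower_bound:
  fixes s :: real and n K h l :: nat
  assumes sect: "D_secting n {-1, 0, 1} (k_subsets n (int K)) F'" and F': "F' \<subseteq> Pow {1..n}"
    and K: "K mod 4 = 2" and h: "h \<le> K" "2 * h \<le> n" "K + 2 * l = 2 * h" "0 < h"
    and s: "0 < s" "s \<le> 1/4" "s * (2 * h) \<le> l"
  shows "exp (s\<^sup>2 / 16000 * h) \<le> 2 * real h * 2 ^ card F'"
proof -
  define T where "T = {x. x \<subseteq> {1..2*h} \<and> card x = h}"
  define \<phi> where "\<phi> x = {B \<in> F'. odd (card (x \<inter> B))}" for x
  have finF': "finite F'" using F' by (rule finite_subset) simp
  have cardT: "card T = (2 * h) choose h"
    unfolding T_def using n_subsets[of "{1..2*h}" h] by simp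
  have finT: "finite T" by (rule finite_subset[of _ "Pow {1..2*h}"]) (auto simp: T_def)
  obtain P where P: "card T \<le> 2 ^ card F' * card {x \<in> T. \<phi> x = P}"
  proof -
    have "\<exists>P\<in>Pow F'. card T \<le> card (\<phi> -` {P} \<inter> T) * card (Pow F')"
      using finT finF' by (intro pigeonhole_card) (auto simp: \<phi>_def)
    moreover have "\<phi> -` {P} \<inter> T = {x \<in> T. \<phi> x = P}" for P by auto
    ultimately show thesis using that finF' by (auto simp: card_Pow mult.commute)
  qed
  define C where "C = {x \<in> T. \<phi> x = P}"
  have avoid: "card (x \<inter> y) \<noteq> l" if xy: "x \<in> C" "y \<in> C" for x y
  proof
    assume l: "card (x \<inter> y) = l"
    define A where "A = sym_diff x y"
    have sub: "x \<subseteq> {1..2*h}" "y \<subseteq> {1..2*h}" and xy_card: "card x = h" "card y = h"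
      using xy by (auto simp: C_def T_def)
    have fin: "finite x" "finite y" using sub finite_subset by blast+
    have "{1..2*h} \<subseteq> {1..n}" using h(2) by simp
    then have A: "A \<subseteq> {1..n}" using sub by (auto simp: A_def)
    have cardA: "card A = K"
      using card_sym_diff[OF fin] l xy_card h(3) by (simp add: A_def)
    with A sect obtain B where B: "B \<in> F'"
      and disc: "int (card (A \<inter> B)) - int (card (A \<inter> ({1..n} - B))) \<in> {-1, 0, 1}"
      by (auto simp: D_secting_def k_subsets_def)
    have "A \<inter> ({1..n} - B) = A - B" using A by auto
    moreover have "card (A \<inter> B) + card (A - B) = K"
      using cardA card_Int_Diff[of A B] fin by (simp add: A_def)
    \<comment> \<open>The discrepancy is \<open>2 * card (A \<inter> B) - K\<close>; since
      \<open>K\<close> is even, it can only be 0.\<close>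
    ultimately have "2 * card (A \<inter> B) = K" using disc K by (auto; presburger)
    then have "odd (card (A \<inter> B))" using K by presburger
    moreover have "odd (card (x \<inter> B)) \<longleftrightarrow> odd (card (y \<inter> B))"
      using xy B by (auto simp: C_def \<phi>_def)
    moreover have "A \<inter> B = sym_diff (x \<inter> B) (y \<inter> B)" by (auto simp: A_def)
    then have "card (A \<inter> B) + 2 * card (x \<inter> B \<inter> (y \<inter> B)) = card (x \<inter> B) + card (y \<inter> B)"
      using fin card_sym_diff[of "x \<inter> B" "y \<inter> B"] by simp
    ultimately show False by presburger
  qed
  have "C \<subseteq> Pow {1..2*h}" by (auto simp: C_def T_def)
  moreover have "4 * l \<le> 2 * h" using h by linarith
  moreover have "s * real (2 * h) \<le> l" using s(3) by simp
  ultimately have "real (card C) * real (card C) \<le> 4 ^ (2 * h) * exp (- (s\<^sup>2 / 16000 * real (2 * h)))"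
    by (intro forbidden_cross_intersection[where S = "{1..2*h}" and l = l, OF s(1,2) _ _ _ _ _ _ avoid]) simp_all
  also have "\<dots> = (4 ^ h * exp (- (s\<^sup>2 / 16000 * h)))\<^sup>2"
  proof -
    have "exp (- (s\<^sup>2 / 16000 * real (2 * h))) = (exp (- (s\<^sup>2 / 16000 * h)))\<^sup>2"
      by (simp flip: exp_double)
    then show ?thesis by (simp only: power_mult_distrib power_even_eq)
  qed
  finally have "(real (card C))\<^sup>2 \<le> (4 ^ h * exp (- (s\<^sup>2 / 16000 * h)))\<^sup>2"
    unfolding power2_eq_square[of "real (card C)"] .
  then have C_le: "card C \<le> 4 ^ h * exp (- (s\<^sup>2 / 16000 * h))"
    by (rule power2_le_imp_le) simp
  \<comment> \<open>The middle layer is within a factor \<open>2 * h\<close> of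
    \<open>4 ^ h\<close>, so the exponential saving must be paid for by the number of
    classes.\<close>
  have "4 ^ h / (2 * real h) \<le> real ((2 * h) choose h)"
    using central_binomial_lower_bound[OF h(4)] .
  also have "\<dots> \<le> real (2 ^ card F' * card C)"
    using P unfolding cardT C_def by (rule of_nat_mono)
  also have "\<dots> = 2 ^ card F' * real (card C)" by simp
  also have "\<dots> \<le> 2 ^ card F' * (4 ^ h * exp (- (s\<^sup>2 / 16000 * h)))"
    using C_le by (intro mult_left_mono) auto
  finally have "4 ^ h * 1 \<le> 4 ^ h * (2 * real h * 2 ^ card F' * exp (- (s\<^sup>2 / 16000 * h)))"
    using h(4) by (simp add: field_simps)
  then have "1 \<le> 2 * real h * 2 ^ card F' * exp (- (s\<^sup>2 / 16000 * h))" by simp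
  then show ?thesis by (simp add: exp_minus field_simps)
qed

section \<open>The linear lower bound\<close>

lemma beta_le_beta_pm1:
  assumes "F \<subseteq> k_subsets n k"
  shows "beta n {-1, 0, 1} F \<le> beta_pm1 n k"
proof -
  have "finite (k_subsets n k)"
    by (rule finite_subset[of _ "Pow {1..n}"]) (auto simp: k_subsets_def)
  then have "finite (beta n {-1, 0, 1} ` Pow (k_subsets n k))" by simp
  moreover have "{beta n {-1, 0, 1} F | F. F \<subseteq> k_subsets n k} = beta n {-1, 0, 1} ` Pow (k_subsets n k)"
    by auto
  ultimately show ?thesis
    unfolding beta_pm1_def using assms by (intro Max_ge) auto
qed

lemma beta_pm1_secting_family:
  obtains F' where "F' \<subseteq> Pow {1..n}" "D_secting n {-1, 0, 1} (k_subsets n k) F'"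
    "card F' \<le> beta_pm1 n k"
proof -
  have "k_subsets n k \<subseteq> Pow {1..n}" by (auto simp: k_subsets_def)
  from beta_attained[OF this] show ?thesis
    using that beta_le_beta_pm1[of "k_subsets n k" n k] by (metis order_refl)
qed

lemma beta_pm1_pos:
  assumes "0 \<le> k" "k \<le> int n"
  shows "1 \<le> beta_pm1 n k"
proof -
  obtain F' where F': "F' \<subseteq> Pow {1..n}" "D_secting n {-1, 0, 1} (k_subsets n k) F'"
    "card F' \<le> beta_pm1 n k" by (rule beta_pm1_secting_family)
  have "{1..nat k} \<in> k_subsets n k" using assms by (auto simp: k_subsets_def)
  then have "F' \<noteq> {}" using F'(2) by (auto simp: D_secting_def)
  moreover have "finite F'" using F'(1) by (rule finite_subset) simp
  ultimately have "1 \<le> card F'" by (simp add: Suc_leI card_gt_0_iff)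
  then show ?thesis using F'(3) by simp
qed

lemma beta_pm1_linear:
  fixes c :: real and n K :: nat
  assumes c: "0 < c" "c < 1/2" and K: "K mod 4 = 2" "c * n \<le> 2 * K" "K < (1 - c) * n"
  defines "\<kappa> \<equiv> (c / 4)\<^sup>2 / 16000"
  assumes n: "32 / (c * \<kappa>\<^sup>2) \<le> n" "2 / c \<le> n"
  shows "\<kappa> * c / 4 * n \<le> beta_pm1 n (int K)"
proof -
  have \<kappa>: "0 < \<kappa>" using c by (simp add: \<kappa>_def)
  have cn: "2 \<le> c * n" using n(2) c by (simp add: field_simps)
  have n_big: "4 \<le> real n"
  proof -
    have "c * n \<le> 1/2 * n" using c by (intro mult_right_mono) auto
    then show ?thesis using cn by simp
  qed
  \<comment> \<open>The largest \<open>h\<close> with \<open>h \<le> K\<close> and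
    \<open>2 * h \<le> n\<close>. Then \<open>l\<close> is \<open>K / 2\<close> for small
    \<open>K\<close> and about \<open>(n - K) / 2\<close> otherwise, in both cases linear in
    \<open>n\<close>.\<close>
  define h where "h = min K (n div 2)"
  define l where "l = h - K div 2"
  have Kn: "K < n"
  proof -
    have "(1 - c) * n \<le> 1 * real n" using c by (intro mult_right_mono) auto
    then show ?thesis using K(3) by simp
  qed
  have "K \<le> 2 * h" using Kn by (auto simp: h_def)
  then have l: "K + 2 * l = 2 * h" using K(1) unfolding l_def by presburger
  have h2: "2 * h \<le> n" "h \<le> K" by (auto simp: h_def)
  have half: "real n - 1 \<le> 2 * real (n div 2)" by linarith
  have h_ge: "c * n / 2 \<le> h"
  proof (cases "K \<le> n div 2")
    case True
    then show ?thesis using K(2) by (simp add: h_def)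
  next
    case False
    moreover have "c * n \<le> 1/2 * real n" using c by (intro mult_right_mono) auto
    moreover have "1/2 * real n \<le> 2 * real (n div 2)" using half n_big by linarith
    ultimately show ?thesis by (simp add: h_def)
  qed
  have l_ge: "c / 4 * (2 * h) \<le> l"
  proof (cases "K \<le> n div 2")
    case True
    then have "h = 2 * l" using l by (simp add: h_def)
    moreover have "c * real l \<le> 1 * real l" using c by (intro mult_right_mono) auto
    ultimately show ?thesis by simp
  next
    case False
    then have "real K + 2 * real l = 2 * real (n div 2)" using l by (simp add: h_def)
    then have "c * n / 4 \<le> l" using half K(3) cn by (simp add: algebra_simps)
    moreover have "c / 4 * (2 * h) \<le> c / 4 * n" using c h2 by (intro mult_left_mono) auto
    ultimately show ?thesis by simp
  qed
  have h_pos: "0 < h" using h_ge cn by (cases "h = 0") auto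
  obtain F' where F': "F' \<subseteq> Pow {1..n}" "D_secting n {-1, 0, 1} (k_subsets n (int K)) F'"
    "card F' \<le> beta_pm1 n (int K)" by (rule beta_pm1_secting_family)
  have "exp (\<kappa> * h) \<le> 2 * real h * 2 ^ card F'"
    unfolding \<kappa>_def using c
    by (intro secting_family_lower_bound[OF F'(2,1) K(1) h2(2,1) l h_pos]) (use l_ge in auto)
  \<comment> \<open>For large \<open>n\<close>, half of the exponent absorbs the factor
    \<open>2 * h\<close>.\<close>
  also have "\<dots> \<le> exp (\<kappa> * h / 2) * 2 ^ card F'"
  proof (rule mult_right_mono)
    have "32 / \<kappa>\<^sup>2 = c * (32 / (c * \<kappa>\<^sup>2))" using c by simp
    also have "\<dots> \<le> c * n" using n(1) c by (intro mult_left_mono) auto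
    finally have "32 / \<kappa>\<^sup>2 \<le> c * n" .
    then have "16 / \<kappa>\<^sup>2 \<le> h" using h_ge by simp
    then have "16 \<le> \<kappa>\<^sup>2 * h" using \<kappa> by (simp add: field_simps)
    then have "16 * real h \<le> \<kappa>\<^sup>2 * h * h" by (intro mult_right_mono) auto
    then have "2 * real h \<le> (\<kappa> * h / 2)\<^sup>2 / 2" by (simp add: power2_eq_square field_simps)
    also have "\<dots> \<le> exp (\<kappa> * h / 2)"
    proof -
      have "0 \<le> \<kappa> * h / 2" using \<kappa> by simp
      then show ?thesis using exp_lower_Taylor_quadratic[of "\<kappa> * h / 2"] by linarith
    qed
    finally show "2 * real h \<le> exp (\<kappa> * h / 2)" by simp
  qed simp
  also have "(2::real) ^ card F' \<le> exp (card F')"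
  proof -
    have "(2::real) ^ card F' \<le> exp 1 ^ card F'"
      using exp_ge_add_one_self[of 1] by (intro power_mono) auto
    then show ?thesis by (simp flip: exp_of_nat_mult)
  qed
  finally have "exp (\<kappa> * h) \<le> exp (\<kappa> * h / 2 + card F')"
    by (simp add: exp_add)
  then have "\<kappa> * h / 2 \<le> card F'" by simp
  moreover have "\<kappa> / 2 * (c * n / 2) \<le> \<kappa> / 2 * h" using \<kappa> h_ge by (intro mult_left_mono) auto
  ultimately show ?thesis using F'(3) by simp
qed

theorem theorem5:
  fixes c :: real
  assumes "0 < c" and "c < 1 / 2"
  shows "\<exists>\<delta>::real. \<delta> > 0 \<and>
           (\<forall>(n::nat) (k::int). c * real n < real_of_int k \<and> real_of_int k < (1 - c) * real n \<longrightarrow>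
              real (Max {beta_pm1 n k, beta_pm1 n (k - 1), beta_pm1 n (k - 2), beta_pm1 n (k - 3)})
                \<ge> \<delta> * real n)"
proof -
  define \<kappa> where "\<kappa> = (c / 4)\<^sup>2 / 16000"
  \<comment> \<open>The term \<open>6 / c\<close> gives \<open>6 \<le> c * n\<close>, so lowering
    \<open>k\<close> by at most 3 keeps \<open>c * n \<le> 2 * K\<close>. For \<open>n < n0\<close>,
    the choice \<open>\<delta> \<le> 1 / n0\<close> leaves only the bound 1 to prove.\<close>
  define n0 where "n0 = 32 / (c * \<kappa>\<^sup>2) + 6 / c"
  define \<delta> where "\<delta> = min (\<kappa> * c / 4) (1 / n0)"
  have pos: "0 < \<kappa>" "0 < n0" using assms by (auto simp: \<kappa>_def n0_def intro!: add_pos_pos)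
  have "\<delta> * n \<le> Max {beta_pm1 n k, beta_pm1 n (k - 1), beta_pm1 n (k - 2), beta_pm1 n (k - 3)}"
    (is "_ \<le> real (Max ?M)")
    if k: "c * n < k" "k < (1 - c) * n" for n :: nat and k :: int
  proof -
    have "0 \<le> c * n" using assms by simp
    then have "0 < k" using k(1) by linarith
    have "(1 - c) * n \<le> 1 * real n" using assms by (intro mult_right_mono) auto
    then have "k < n" using k(2) by linarith
    have Max_ge: "real b \<le> Max ?M" if "b \<in> ?M" for b
      using that by (intro of_nat_mono Max_ge) auto
    show ?thesis
    proof (cases "n0 \<le> n")
      case False
      have "\<delta> * n \<le> 1 / n0 * n" by (intro mult_right_mono) (auto simp: \<delta>_def)
      also have "\<dots> \<le> 1" using False pos by (simp add: field_simps)
      also have "\<dots> \<le> beta_pm1 n k" using beta_pm1_pos[of k n] \<open>0 < k\<close> \<open>k < n\<close> by simp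
      also have "\<dots> \<le> Max ?M" by (rule Max_ge) simp
      finally show ?thesis .
    next
      case True
      define i where "i = (k - 2) mod 4"
      have i: "i \<in> {0, 1, 2, 3}" "(k - i) mod 4 = 2" unfolding i_def by auto presburger+
      define K where "K = nat (k - i)"
      have "0 \<le> 32 / (c * \<kappa>\<^sup>2)" "0 \<le> 6 / c" "2 / c \<le> 6 / c"
        using assms by (auto simp: divide_right_mono)
      then have n: "32 / (c * \<kappa>\<^sup>2) \<le> n" "2 / c \<le> n" "6 / c \<le> n"
        using True unfolding n0_def by linarith+
      have cn: "6 \<le> c * n" using n(3) assms by (simp add: field_simps)
      then have "0 \<le> k - i" using i(1) k(1) by auto
      then have K: "int K = k - i" by (simp add: K_def)
      then have rK: "real K = k - i" by (metis of_int_of_nat_eq)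
      have "K mod 4 = 2" using K i(2) by presburger
      moreover have "c * n \<le> 2 * real K" "K < (1 - c) * n"
        unfolding rK using k cn i(1) by auto
      ultimately have "\<kappa> * c / 4 * n \<le> beta_pm1 n (int K)"
        unfolding \<kappa>_def using assms n by (intro beta_pm1_linear) (auto simp: \<kappa>_def)
      also have "\<dots> \<le> Max ?M"
        unfolding K using i(1) by (intro Max_ge) auto
      finally have "\<kappa> * c / 4 * n \<le> Max ?M" .
      moreover have "\<delta> * n \<le> \<kappa> * c / 4 * n" by (intro mult_right_mono) (auto simp: \<delta>_def)
      ultimately show ?thesis by linarith
    qed
  qed
  moreover have "0 < \<delta>" using pos assms by (simp add: \<delta>_def)
  ultimately show ?thesis by blast
qed

end
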